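(* Let $\Sigma_5=\{0,1,2,3,4\}$ and let $g:\Sigma_5^*\to\{0,1\}^*$ be the morphism $g(0)=011100$, $g(1)=101100$, $g(2)=111000$, $g(3)=110010$, $g(4)=110001$. If $w\in\Sigma_5^*$ is squarefree and contains none of the subwords $02,03,04,13,14,20,24,30,31,41,42,434010$, then the only squares occurring as subwords of $g(w)$ are $00$, $11$ and $0101$.
   Context: A square is a nonempty word $xx$; squarefree means containing no square as a (contiguous) subword. *)

theory Defs
  imports Main "HOL-Library.Sublist"
begin

(* Words are lists; "subword" (contiguous factor) is the library's sublist. *)

definition is_square :: "'a list \<Rightarrow> bool" where
  "is_square u \<longleftrightarrow> (\<exists>x. x \<noteq> [] \<and> u = x @ x)"

definition squarefree_word :: "'a list \<Rightarrow> bool" where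
  "squarefree_word w \<longleftrightarrow> (\<forall>u. sublist u w \<longrightarrow> \<not> is_square u)"

definition Sigma5 :: "nat set" where
  "Sigma5 = {0, 1, 2, 3, 4}"

(* Only the values on Sigma5 matter. *)
definition g_letter :: "nat \<Rightarrow> nat list" where
  "g_letter a =
    (if a = 0 then [0,1,1,1,0,0]
     else if a = 1 then [1,0,1,1,0,0]
     else if a = 2 then [1,1,1,0,0,0]
     else if a = 3 then [1,1,0,0,1,0]
     else if a = 4 then [1,1,0,0,0,1]
     else [])"

definition g :: "nat list \<Rightarrow> nat list" where
  "g w = concat (map g_letter w)"

definition forbidden :: "nat list set" where
  "forbidden =
    {[0,2], [0,3], [0,4], [1,3], [1,4], [2,0], [2,4], [3,0], [3,1], [4,1], [4,2],
     [4,3,4,0,1,0]}"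

end

theory Submission
  imports Defs
begin

text \<open>
  Every letter has an image of length 6. A factor of \<open>g w\<close> of length 19 determines its position
  modulo 6, so the period of a square in \<open>g w\<close> is either at most 18 or a multiple of 6. A square of
  period at most 18 lies in the image of a factor of \<open>w\<close> of length at most 7, which leaves finitely
  many cases. If the period is \<open>6 * q\<close>, then \<open>w\<close> has a factor \<open>a u b u c\<close> with \<open>length u = q - 1\<close>,
  where for some \<open>r < 6\<close> the images of \<open>a\<close> and \<open>b\<close> agree from index \<open>r\<close> on and those of \<open>b\<close> and
  \<open>c\<close> agree before index \<open>r\<close>. For this \<open>g\<close> that forces \<open>a = b\<close> or \<open>b = c\<close>, and \<open>w\<close> contains a square.
\<close>

section \<open>Admissible words and their factors\<close>

definition admissible :: "nat list \<Rightarrow> bool" where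
  "admissible w \<longleftrightarrow>
    w \<in> lists Sigma5 \<and> squarefree_word w \<and> (\<forall>f \<in> forbidden. \<not> sublist f w)"

lemma sublist_take_drop: "sublist (take m (drop k xs)) xs"
  by (meson sublist_drop sublist_order.order_trans sublist_take)

lemma admissible_sublist:
  assumes "admissible w" and "sublist v w"
  shows "admissible v"
proof -
  have "v \<in> lists Sigma5"
    using assms set_mono_sublist by (fastforce simp: admissible_def)
  moreover have "sublist u w" if "sublist u v" for u
    using that assms(2) by (rule sublist_order.order_trans)
  ultimately show ?thesis
    using assms(1) unfolding admissible_def squarefree_word_def by blast
qed

text \<open>Index form of squarefreeness: a square in \<open>g w\<close> with period divisible by 6
  yields equalities between letters of \<open>w\<close> at distance \<open>q\<close>, not a factor
  of \<open>w\<close> given as a list.\<close>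

lemma squarefree_word_no_period:
  assumes "squarefree_word w" and "0 < q" and "k + 2 * q \<le> length w"
  shows "\<exists>t<q. w ! (k + t) \<noteq> w ! (k + q + t)"
proof (rule ccontr)
  assume "\<not> ?thesis"
  then have eq: "w ! (k + t) = w ! (k + q + t)" if "t < q" for t
    using that by blast
  let ?x = "take q (drop k w)"
  have "?x = take q (drop (k + q) w)"
    using assms(3) by (intro nth_equalityI) (auto simp: eq)
  then have "take (2 * q) (drop k w) = ?x @ ?x"
    by (simp add: mult_2 take_add add.commute)
  moreover have "?x \<noteq> []"
    using assms(2,3) by auto
  ultimately show False
    using assms(1) sublist_take_drop unfolding squarefree_word_def is_square_def by blast
qed

subsection \<open>Enumeration of short admissible words\<close>

text \<open>Testing prefixes suffices because words are extended on the left: a factor of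
  \<open>a # v\<close> that is not a prefix already lies in \<open>v\<close>. Lists replace the set
  \<open>forbidden\<close> to keep the test executable.\<close>

definition good_prefixes :: "nat list \<Rightarrow> bool" where
  "good_prefixes w \<longleftrightarrow>
    list_all (\<lambda>f. \<not> prefix f w)
      [[0,2], [0,3], [0,4], [1,3], [1,4], [2,0], [2,4], [3,0], [3,1], [4,1], [4,2],
       [4,3,4,0,1,0]] \<and>
    list_all (\<lambda>p. take p w \<noteq> take p (drop p w)) [1..<Suc (length w div 2)]"

fun admissible_words :: "nat \<Rightarrow> nat list list" where
  "admissible_words 0 = [[]]"
| "admissible_words (Suc n) =
    concat (map (\<lambda>v. filter good_prefixes (map (\<lambda>a. a # v) [0,1,2,3,4])) (admissible_words n))"

lemma good_prefixes_admissible: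
  assumes "admissible w"
  shows "good_prefixes w"
proof -
  have "take p w \<noteq> take p (drop p w)" if p: "1 \<le> p" "p \<le> length w div 2" for p
  proof
    assume "take p w = take p (drop p w)"
    then have "take (2 * p) w = take p w @ take p w"
      by (simp add: mult_2 take_add)
    moreover have "take p w \<noteq> []"
      using p by auto
    ultimately show False
      using assms unfolding admissible_def squarefree_word_def is_square_def
      by (metis sublist_take)
  qed
  moreover have "\<forall>f \<in> forbidden. \<not> prefix f w"
    using assms unfolding admissible_def by blast
  ultimately show ?thesis
    unfolding good_prefixes_def forbidden_def list_all_iff by auto
qed

lemma admissible_in_admissible_words:
  "admissible v \<Longrightarrow> v \<in> set (admissible_words (length v))"
proof (induction v)
  case (Cons a v)
  have "admissible v"
    using Cons.prems by (rule admissible_sublist) (simp add: sublist_Cons_right)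
  moreover have "a \<in> {0,1,2,3,4}"
    using Cons.prems by (auto simp: admissible_def Sigma5_def)
  ultimately show ?case
    using Cons.IH good_prefixes_admissible[OF Cons.prems] by auto
qed simp

subsection \<open>Factors of images\<close>

lemma length_g_letter: "a \<in> Sigma5 \<Longrightarrow> length (g_letter a) = 6"
  by (auto simp: Sigma5_def g_letter_def)

lemma g_Cons: "g (a # w) = g_letter a @ g w"
  by (simp add: g_def)

lemma length_g: "w \<in> lists Sigma5 \<Longrightarrow> length (g w) = 6 * length w"
  by (induction w) (auto simp: g_Cons length_g_letter, simp add: g_def)

lemma drop_g: "w \<in> lists Sigma5 \<Longrightarrow> drop (6 * k) (g w) = g (drop k w)"
proof (induction k arbitrary: w)
  case (Suc k)
  then show ?case
    by (cases w) (auto simp: g_Cons length_g_letter, simp add: g_def)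
qed simp

lemma take_g: "w \<in> lists Sigma5 \<Longrightarrow> take (6 * k) (g w) = g (take k w)"
proof (induction k arbitrary: w)
  case (Suc k)
  then show ?case
    by (cases w) (auto simp: g_Cons length_g_letter, simp add: g_def)
qed (simp add: g_def)

text \<open>A window that starts at offset \<open>r\<close> in block \<open>k\<close> ends within
  the next \<open>m\<close> blocks, so \<open>m\<close> letters of \<open>w\<close> determine it,
  even where the end of \<open>w\<close> truncates it.\<close>

lemma factor_g:
  assumes "w \<in> lists Sigma5" and "r + n \<le> 6 * m"
  shows "take n (drop (6 * k + r) (g w)) = take n (drop r (g (take m (drop k w))))"
proof -
  have w: "drop k w \<in> lists Sigma5"
    using assms(1) by (auto dest: in_set_dropD)
  have "take n (drop r (g (take m (drop k w)))) = take n (drop r (take (6 * m) (g (drop k w))))"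
    using w by (simp add: take_g)
  also have "\<dots> = take n (drop r (g (drop k w)))"
    using assms(2) by (simp add: drop_take min_def)
  also have "\<dots> = take n (drop (6 * k + r) (g w))"
    using assms(1) by (simp add: drop_g[symmetric] add.commute)
  finally show ?thesis by simp
qed

lemma nth_g:
  assumes "w \<in> lists Sigma5" and "k < length w" and "r < 6"
  shows "g w ! (6 * k + r) = g_letter (w ! k) ! r"
proof -
  have k: "w ! k \<in> Sigma5"
    using assms by (auto simp: lists_eq_set)
  have "g w ! (6 * k + r) = drop (6 * k) (g w) ! r"
    using assms by (simp add: length_g)
  also have "\<dots> = (g_letter (w ! k) @ g (drop (Suc k) w)) ! r"
    using assms by (simp add: drop_g flip: Cons_nth_drop_Suc g_Cons)
  also have "\<dots> = g_letter (w ! k) ! r"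
    using k assms(3) by (simp add: nth_append length_g_letter)
  finally show ?thesis .
qed

subsection \<open>The finite checks\<close>

text \<open>Only squares at the front are tested; the offset \<open>r\<close> in the check moves the
  front. The length guard excludes equalities caused by truncation in \<open>take\<close>.\<close>

definition only_known_square_prefixes :: "nat list \<Rightarrow> bool" where
  "only_known_square_prefixes t \<longleftrightarrow>
    list_all (\<lambda>p. 2 * p \<le> length t \<longrightarrow> take p t = take p (drop p t) \<longrightarrow>
        take p t = [0] \<or> take p t = [1] \<or> take p t = [0,1]) [1..<19]"

text \<open>Seven letters suffice: a square of period at most 18 at offset at most 5 ends by
  position 5 + 36 = 41 < 42. Shorter words account for squares near the end of
  \<open>w\<close>.\<close>

lemma short_squares_check:
  "list_all (\<lambda>n. list_all (\<lambda>v. list_all (\<lambda>r. only_known_square_prefixes (drop r (g v))) [0..<6])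
     (admissible_words n)) [0..<8]"
  by code_simp

text \<open>Four letters have an image of length 24 = 5 + 19, so every offset leaves a full window
  of 19.\<close>

lemma phase_check:
  "list_all (\<lambda>v. list_all (\<lambda>v'. list_all (\<lambda>r. list_all (\<lambda>r'.
       take 19 (drop r (g v)) = take 19 (drop r' (g v')) \<longrightarrow> r = r') [0..<6]) [0..<6])
     (admissible_words 4)) (admissible_words 4)"
  by code_simp

text \<open>The instance \<open>r = 0\<close>, \<open>c = a\<close> is injectivity of
  \<open>g_letter\<close>, which is also used below.\<close>

lemma letter_check:
  "list_all (\<lambda>a. list_all (\<lambda>b. list_all (\<lambda>c. list_all (\<lambda>r.
       list_all (\<lambda>j. g_letter a ! j = g_letter b ! j) [r..<6] \<longrightarrow>
       list_all (\<lambda>j. g_letter b ! j = g_letter c ! j) [0..<r] \<longrightarrow>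
       a = b \<or> b = c) [0..<6]) [0,1,2,3,4]) [0,1,2,3,4]) [0,1,2,3,4]"
  by code_simp

section \<open>Squares of period at most 18\<close>

lemma short_square_in_image:
  assumes "admissible w" and "sublist (x @ x) (g w)" and "x \<noteq> []" and "length x \<le> 18"
  shows "x \<in> {[0], [1], [0,1]}"
proof -
  obtain ps ss where g: "g w = ps @ (x @ x) @ ss"
    using assms(2) unfolding sublist_def by blast
  define k r p where "k = length ps div 6" and "r = length ps mod 6" and "p = length x"
  define v where "v = take 7 (drop k w)"
  have "admissible v"
    unfolding v_def using assms(1) sublist_take_drop by (rule admissible_sublist)
  moreover have "length v \<in> set [0..<8]"
    by (auto simp: v_def)
  moreover have "r \<in> set [0..<6]"
    by (auto simp: r_def)
  ultimately have check: "only_known_square_prefixes (drop r (g v))"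
    using short_squares_check admissible_in_admissible_words unfolding list_all_iff by blast
  have "take (2 * p) (drop (6 * k + r) (g w)) = take (2 * p) (drop r (g v))"
    unfolding v_def using assms(1,4) by (intro factor_g) (auto simp: admissible_def r_def p_def)
  moreover have "6 * k + r = length ps"
    by (simp add: k_def r_def)
  ultimately have xx: "take (2 * p) (drop r (g v)) = x @ x"
    by (simp add: g p_def)
  have len: "2 * p \<le> length (drop r (g v))"
    using arg_cong[OF xx, of length] by (simp add: p_def)
  have "take p (drop r (g v)) = take p (take (2 * p) (drop r (g v)))"
    by simp
  then have 1: "take p (drop r (g v)) = x"
    unfolding xx by (simp add: p_def)
  have "take p (drop p (drop r (g v))) = drop p (take (2 * p) (drop r (g v)))"
    by (simp add: drop_take)
  then have 2: "take p (drop p (drop r (g v))) = x"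
    unfolding xx by (simp add: p_def)
  have "p \<in> set [1..<19]"
    using assms(3,4) by (auto simp: p_def Suc_le_eq)
  with check len 1 2 show ?thesis
    unfolding only_known_square_prefixes_def list_all_iff by auto
qed

section \<open>Squares of period at least 19\<close>

lemma long_square_period:
  assumes "admissible w" and "i + 2 * p \<le> length (g w)" and "19 \<le> p"
    and period: "\<And>j. j < p \<Longrightarrow> g w ! (i + j) = g w ! (i + p + j)"
  shows "6 dvd p"
proof -
  have w: "w \<in> lists Sigma5"
    using assms(1) by (simp add: admissible_def)
  define block where "block i' = take 4 (drop (i' div 6) w)" for i'
  have block: "block i' \<in> set (admissible_words 4)"
    "take 19 (drop i' (g w)) = take 19 (drop (i' mod 6) (g (block i')))"
    if "i' + 19 \<le> length (g w)" for i'
  proof -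
    have "admissible (block i')"
      unfolding block_def using assms(1) sublist_take_drop by (rule admissible_sublist)
    \<comment> \<open>Since 19 > 3 * 6, the window reaches a fourth block at any offset, and
      \<open>g w\<close> consists of whole blocks.\<close>
    moreover have "length (block i') = 4"
      using that by (simp add: block_def length_g[OF w])
    ultimately show "block i' \<in> set (admissible_words 4)"
      using admissible_in_admissible_words by metis
    show "take 19 (drop i' (g w)) = take 19 (drop (i' mod 6) (g (block i')))"
      using factor_g[OF w, of "i' mod 6" 19 4 "i' div 6"] by (simp add: block_def)
  qed
  have "take 19 (drop i (g w)) = take 19 (drop (i + p) (g w))"
    using assms(2,3) by (intro nth_equalityI) (auto simp: period)
  then have "take 19 (drop (i mod 6) (g (block i)))
      = take 19 (drop ((i + p) mod 6) (g (block (i + p))))"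
    using block(2)[of i] block(2)[of "i + p"] assms(2,3) by simp
  moreover have "i mod 6 \<in> set [0..<6]" "(i + p) mod 6 \<in> set [0..<6]"
    by auto
  moreover have "block i \<in> set (admissible_words 4)" "block (i + p) \<in> set (admissible_words 4)"
    using assms(2,3) by (auto intro!: block(1))
  ultimately have "i mod 6 = (i + p) mod 6"
    using phase_check unfolding list_all_iff by blast
  then show ?thesis
    by presburger
qed

lemma letters_agreeing_around:
  assumes "{a, b, c} \<subseteq> Sigma5" and "r < 6"
    and "\<And>j. r \<le> j \<Longrightarrow> j < 6 \<Longrightarrow> g_letter a ! j = g_letter b ! j"
    and "\<And>j. j < r \<Longrightarrow> g_letter b ! j = g_letter c ! j"
  shows "a = b \<or> b = c"
proof -
  have "a \<in> set [0,1,2,3,4]" "b \<in> set [0,1,2,3,4]" "c \<in> set [0,1,2,3,4]" "r \<in> set [0..<6]"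
    using assms(1,2) by (auto simp: Sigma5_def)
  moreover have "\<forall>j \<in> set [r..<6]. g_letter a ! j = g_letter b ! j"
    "\<forall>j \<in> set [0..<r]. g_letter b ! j = g_letter c ! j"
    using assms(3,4) by auto
  ultimately show ?thesis
    using letter_check unfolding list_all_iff by blast
qed

text \<open>Both halves of the square cut the blocks of \<open>g w\<close> at the same offset
  \<open>r\<close>. Letters inside a half are compared on their whole images; only those at
  \<open>k\<close>, \<open>k + q\<close> and \<open>k + 2 * q\<close> may be compared in
  part.\<close>

lemma no_square_with_aligned_period:
  assumes "admissible w" and "0 < q" and len: "i + 2 * (6 * q) \<le> length (g w)"
    and period: "\<And>j. j < 6 * q \<Longrightarrow> g w ! (i + j) = g w ! (i + 6 * q + j)"
  shows False
proof -
  have w: "w \<in> lists Sigma5" and sf: "squarefree_word w"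
    using assms(1) by (auto simp: admissible_def)
  define k r where "k = i div 6" and "r = i mod 6"
  have i: "i = 6 * k + r" and r: "r < 6"
    by (auto simp: k_def r_def)
  have len': "6 * k + r + 12 * q \<le> 6 * length w"
    using len by (simp add: i length_g[OF w])
  have letter: "w ! t \<in> Sigma5" if "t < length w" for t
    using w that by (auto simp: lists_eq_set)
  \<comment> \<open>The bounds on \<open>6 * t + j\<close> say that position
    \<open>6 * (k + t) + j\<close> lies in the first half of the square.\<close>
  have agree: "g_letter (w ! (k + t)) ! j = g_letter (w ! (k + q + t)) ! j"
    if "j < 6" "r \<le> 6 * t + j" "6 * t + j < 6 * q + r" for t j
  proof -
    have "k + q + t < length w"
      using that len' by linarith
    moreover have "g w ! (6 * (k + t) + j) = g w ! (6 * (k + q + t) + j)"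
      using period[of "6 * t + j - r"] that by (simp add: i algebra_simps)
    ultimately show ?thesis
      using that(1) w nth_g[of w "k + t" j] nth_g[of w "k + q + t" j] by simp
  qed
  have inner: "w ! (k + t) = w ! (k + q + t)" if "0 < t" "t < q" for t
  proof -
    have "k + q + t < length w"
      using that len' by linarith
    moreover have "g_letter (w ! (k + t)) ! j = g_letter (w ! (k + q + t)) ! j" if "j < 6" for j
      using agree[of j t] that \<open>0 < t\<close> \<open>t < q\<close> r by linarith
    ultimately show ?thesis
      using letters_agreeing_around[of "w ! (k + t)" "w ! (k + q + t)" "w ! (k + t)" 0] letter
      by auto
  qed
  have first: "g_letter (w ! k) ! j = g_letter (w ! (k + q)) ! j" if "r \<le> j" "j < 6" for j
    using agree[of j 0] that assms(2) by simp
  show False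
  \<comment> \<open>Equality puts a square of \<open>w\<close> at \<open>k\<close>; otherwise the
    letters at \<open>k + q\<close> and \<open>k + 2 * q\<close> agree and the square starts at
    \<open>k + 1\<close>.\<close>
  proof (cases "w ! k = w ! (k + q)")
    case True
    then have "w ! (k + t) = w ! (k + q + t)" if "t < q" for t
      using inner[of t] that by (cases "t = 0") auto
    moreover have "k + 2 * q \<le> length w"
      using len' by linarith
    ultimately show False
      using squarefree_word_no_period[OF sf assms(2)] by blast
  next
    case False
    \<comment> \<open>For \<open>r = 0\<close>, \<open>first\<close> would compare whole images. So
      \<open>r\<close> is positive, and the square runs into block \<open>k + 2 * q\<close>, which
      therefore exists.\<close>
    have "r \<noteq> 0"
    proof
      assume "r = 0"
      moreover have "k + q < length w"
        using len' assms(2) by linarith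
      ultimately show False
        using letters_agreeing_around[of "w ! k" "w ! (k + q)" "w ! k" 0] letter first False
        by auto
    qed
    then have k2: "k + 2 * q < length w"
      using len' by linarith
    have "g_letter (w ! (k + q)) ! j = g_letter (w ! (k + q + q)) ! j" if "j < r" for j
      using agree[of j q] that r assms(2) by simp
    then have last: "w ! (k + q) = w ! (k + q + q)"
      using letters_agreeing_around[of "w ! k" "w ! (k + q)" "w ! (k + q + q)" r]
        letter first False r k2 by auto
    have "w ! (k + 1 + t) = w ! (k + 1 + q + t)" if "t < q" for t
    proof (cases "Suc t = q")
      case True
      then show ?thesis
        using last by (simp add: add.assoc add.commute flip: True)
    next
      case False
      then show ?thesis
        using inner[of "Suc t"] that by simp
    qed
    moreover have "k + 1 + 2 * q \<le> length w"
      using k2 by linarith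
    ultimately show False
      using squarefree_word_no_period[OF sf assms(2)] by blast
  qed
qed

theorem theorem10:
  fixes w :: "nat list"
  assumes "w \<in> lists Sigma5"
    and "squarefree_word w"
    and "\<forall>f \<in> forbidden. \<not> sublist f w"
  shows "\<forall>u. sublist u (g w) \<and> is_square u \<longrightarrow> u \<in> {[0,0], [1,1], [0,1,0,1]}"
proof (intro allI impI)
  fix u
  assume u: "sublist u (g w) \<and> is_square u"
  then obtain x where x: "x \<noteq> []" "u = x @ x"
    unfolding is_square_def by blast
  have w: "admissible w"
    using assms by (simp add: admissible_def)
  obtain ps ss where g: "g w = ps @ (x @ x) @ ss"
    using u x(2) unfolding sublist_def by blast
  have len: "length ps + 2 * length x \<le> length (g w)"
    by (simp add: g)
  have period: "g w ! (length ps + j) = g w ! (length ps + length x + j)" if "j < length x" for j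
    using that by (simp add: g nth_append)
  have "length x \<le> 18"
  proof (rule ccontr)
    assume "\<not> length x \<le> 18"
    then have "6 dvd length x"
      using long_square_period[OF w len _ period] by simp
    then obtain q where q: "length x = 6 * q" ..
    then have "0 < q"
      using x(1) by (cases q) auto
    then show False
      using no_square_with_aligned_period[OF w, of q "length ps"] len period unfolding q by blast
  qed
  then have "x \<in> {[0], [1], [0,1]}"
    using short_square_in_image[OF w] u x by blast
  then show "u \<in> {[0,0], [1,1], [0,1,0,1]}"
    using x(2) by auto
qed

end
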